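(* Let $T:S^1\to S^1$ be an expanding map, i.e. $T\in C^2$ and $|T'(x)|>1$ for all $x\in S^1$, and let $L:L^1(S^1)\to L^1(S^1)$ be its transfer operator. Then $L$ has an invariant density $h\in L^1$, i.e. there is $h\in L^1(S^1)$ with $h\ge 0$, $\int h\,dm=1$ and $Lh=h$.
   Context: $S^1=\mathbb R/\mathbb Z$ with normalized Lebesgue measure $m$. The transfer operator $L$ is the operator on $L^1(m)$ sending the density $f$ of the (signed) measure $f\,m$ to the density of the pushforward measure $A\mapsto \int_{T^{-1}(A)} f\,dm$; explicitly $[Lf](x)=\sum_{y\in T^{-1}(x)}\frac{f(y)}{|T'(y)|}$. *)

theory Defs
  imports "HOL-Analysis.Analysis"
begin

quotient_type circle = real / "\<lambda>x y :: real. x - y \<in> \<int>"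
proof (rule equivpI)
  show "reflp (\<lambda>x y :: real. x - y \<in> \<int>)"
    by (simp add: reflp_def)
  show "symp (\<lambda>x y :: real. x - y \<in> \<int>)"
    by (metis (no_types, lifting) Ints_minus minus_diff_eq sympI)
  show "transp (\<lambda>x y :: real. x - y \<in> \<int>)"
    by (rule transpI) (metis Ints_add diff_add_cancel add_diff_eq)
qed

lift_definition circle_proj :: "real \<Rightarrow> circle" is "\<lambda>x. x" .

lemma circle_proj_eq_iff: "circle_proj x = circle_proj y \<longleftrightarrow> x - y \<in> \<int>"
  by transfer simp

lemma circle_proj_surj: "\<exists>x. p = circle_proj x"
  by transfer (metis Ints_0 diff_self)

text \<open>The circle carries the quotient topology.\<close>

instantiation circle :: topological_space
begin

definition open_circle :: "circle set \<Rightarrow> bool" where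
  "open_circle U \<longleftrightarrow> open (circle_proj -` U)"

instance
  by standard (auto simp: open_circle_def vimage_Union)

end

lemma continuous_circle_proj: "continuous_on UNIV circle_proj"
  by (auto simp: continuous_on_open_vimage open_circle_def)

lemma circle_proj_measurable [measurable]: "circle_proj \<in> borel_measurable borel"
  by (rule borel_measurable_continuous_onI) (rule continuous_circle_proj)

definition circle_measure :: "circle measure" where
  "circle_measure = distr (uniform_measure lborel {0..<1}) borel circle_proj"

lemma sets_circle_measure [simp, measurable_cong]: "sets circle_measure = sets borel"
  by (simp add: circle_measure_def)

lemma space_circle_measure [simp]: "space circle_measure = UNIV"
  by (simp add: circle_measure_def)

lemma prob_space_circle_measure: "emeasure circle_measure UNIV = 1"
  by (simp add: circle_measure_def emeasure_distr)

lemma finite_measure_circle_measure: "finite_measure circle_measure"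
  by (rule finite_measureI) (simp add: prob_space_circle_measure)

text \<open>
  A derivative of a circle map at \<open>p\<close> is the derivative of its expression in the local
  coordinates given by \<open>circle_proj\<close>, that is, of a real function \<open>f\<close> that lifts it near \<open>p\<close>.
  Local coordinates are unique up to integer translations, so the signed derivative is a
  well-defined function on the circle.
\<close>

definition has_circle_deriv :: "(circle \<Rightarrow> circle) \<Rightarrow> real \<Rightarrow> circle \<Rightarrow> bool" where
  "has_circle_deriv T D p \<longleftrightarrow>
    (\<exists>x f. p = circle_proj x \<and>
      (\<forall>\<^sub>F t in nhds x. T (circle_proj t) = circle_proj (f t)) \<and>
      (f has_real_derivative D) (at x))"

definition circle_deriv :: "(circle \<Rightarrow> circle) \<Rightarrow> circle \<Rightarrow> real" where
  "circle_deriv T p = (THE D. has_circle_deriv T D p)"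

lift_definition circle_exp :: "circle \<Rightarrow> complex" is "\<lambda>x. cis (2 * pi * x)"
proof -
  fix x y :: real
  assume "x - y \<in> \<int>"
  then obtain n :: int where "x - y = of_int n"
    by (elim Ints_cases)
  then have "x = y + of_int n"
    by simp
  then have "2 * pi * x = 2 * pi * y + 2 * pi * of_int n"
    by (simp add: distrib_left)
  then show "cis (2 * pi * x) = cis (2 * pi * y)"
    by (metis cis_mult cis_multiple_2pi Ints_of_int mult.right_neutral)
qed

lemma circle_exp_proj: "circle_exp (circle_proj x) = cis (2 * pi * x)"
  by transfer simp

lemma circle_exp_eq_iff: "circle_exp p = circle_exp q \<longleftrightarrow> p = q"
proof
  assume eq: "circle_exp p = circle_exp q"
  obtain x y where p: "p = circle_proj x" and q: "q = circle_proj y"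
    using circle_proj_surj by metis
  have "sin (2 * pi * x) = sin (2 * pi * y) \<and> cos (2 * pi * x) = cos (2 * pi * y)"
    using eq by (simp add: p q circle_exp_proj complex_eq_iff)
  then obtain n :: int where "2 * pi * x = 2 * pi * y + 2 * pi * of_int n"
    using sin_cos_eq_iff[of "2 * pi * x" "2 * pi * y"] by auto
  then have "2 * pi * x = 2 * pi * (y + of_int n)"
    by (simp add: algebra_simps)
  then have "x - y = of_int n"
    by simp
  then show "p = q"
    by (simp add: p q circle_proj_eq_iff)
qed simp

lemma cis_has_vector_derivative: "(cis has_vector_derivative \<i> * cis z) (at z)"
proof -
  have "((\<lambda>w. exp (\<i> * w)) has_field_derivative \<i> * exp (\<i> * of_real z)) (at (of_real z))"
    by (auto intro!: derivative_eq_intros)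
  from has_vector_derivative_real_field[OF this] show ?thesis
    by (simp add: cis_conv_exp[abs_def])
qed

lemma has_circle_deriv_imp:
  assumes "has_circle_deriv T D (circle_proj x)"
  shows "((\<lambda>t. circle_exp (T (circle_proj t))) has_vector_derivative
    (of_real (2 * pi * D) * \<i> * circle_exp (T (circle_proj x)))) (at x)"
proof -
  obtain y f where y: "circle_proj x = circle_proj y"
    and ev: "\<forall>\<^sub>F t in nhds y. T (circle_proj t) = circle_proj (f t)"
    and f: "(f has_real_derivative D) (at y)"
    using assms by (auto simp: has_circle_deriv_def)
  define a where "a = y - x"
  have a: "circle_proj (t + a) = circle_proj t" for t
    using y by (simp add: a_def circle_proj_eq_iff) (metis Ints_minus minus_diff_eq)
  have y_eq: "y = x + a"
    by (simp add: a_def)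
  have "filterlim (\<lambda>t. t + a) (nhds y) (nhds x)"
    unfolding y_eq by (intro tendsto_intros filterlim_ident)
  from filterlim_iff[THEN iffD1, OF this, rule_format, OF ev]
  have ev': "\<forall>\<^sub>F t in nhds x. circle_exp (T (circle_proj t)) = cis (2 * pi * f (t + a))"
    by eventually_elim (simp add: a circle_exp_proj)
  have "((\<lambda>t. f (t + a)) has_real_derivative D) (at x)"
    using f by (simp add: y_eq DERIV_shift)
  then have "((\<lambda>t. 2 * pi * f (t + a)) has_vector_derivative 2 * pi * D) (at x)"
    by (auto intro!: derivative_eq_intros simp flip: has_real_derivative_iff_has_vector_derivative)
  moreover note cis_has_vector_derivative
  ultimately have "(cis \<circ> (\<lambda>t. 2 * pi * f (t + a)) has_vector_derivative
      (2 * pi * D) *\<^sub>R (\<i> * cis (2 * pi * f (x + a)))) (at x)"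
    by (intro vector_diff_chain_at)
  then have "((\<lambda>t. cis (2 * pi * f (t + a))) has_vector_derivative
      of_real (2 * pi * D) * \<i> * cis (2 * pi * f (x + a))) (at x)"
    by (simp add: o_def scaleR_conv_of_real mult.assoc)
  moreover have "cis (2 * pi * f (x + a)) = circle_exp (T (circle_proj x))"
    using eventually_nhds_x_imp_x[OF ev'] by simp
  ultimately show ?thesis
    using ev' has_vector_derivative_cong_ev[where S = UNIV and x = x and
        f = "\<lambda>t. circle_exp (T (circle_proj t))" and g = "\<lambda>t. cis (2 * pi * f (t + a))"] by simp
qed

lemma circle_exp_nonzero: "circle_exp p \<noteq> 0"
  using circle_proj_surj[of p] by (auto simp: circle_exp_proj)

lemma has_circle_deriv_unique:
  assumes "has_circle_deriv T D p" "has_circle_deriv T D' p"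
  shows "D = D'"
proof -
  obtain x where p: "p = circle_proj x"
    using circle_proj_surj by blast
  show ?thesis
    using vector_derivative_unique_at[OF has_circle_deriv_imp[OF assms(1)[unfolded p]]
        has_circle_deriv_imp[OF assms(2)[unfolded p]]] circle_exp_nonzero
    by simp
qed

lemma circle_deriv_eq: "has_circle_deriv T D p \<Longrightarrow> circle_deriv T p = D"
  unfolding circle_deriv_def using has_circle_deriv_unique by blast

definition C2_circle_map :: "(circle \<Rightarrow> circle) \<Rightarrow> bool" where
  "C2_circle_map T \<longleftrightarrow>
    (\<forall>p. \<exists>D. has_circle_deriv T D p) \<and>
    (\<exists>g. (\<forall>x. ((\<lambda>t. circle_deriv T (circle_proj t)) has_real_derivative g x) (at x)) \<and>
      continuous_on UNIV g)"

definition expanding_map :: "(circle \<Rightarrow> circle) \<Rightarrow> bool" where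
  "expanding_map T \<longleftrightarrow> C2_circle_map T \<and> (\<forall>p. \<bar>circle_deriv T p\<bar> > 1)"

text \<open>
  Elements of $L^1$ are represented by integrable functions, equality being equality almost
  everywhere. The function \<open>g\<close> represents the density of the pushforward of the signed measure
  with density \<open>f\<close>.
\<close>

definition is_pushforward_density ::
    "(circle \<Rightarrow> circle) \<Rightarrow> (circle \<Rightarrow> real) \<Rightarrow> (circle \<Rightarrow> real) \<Rightarrow> bool" where
  "is_pushforward_density T f g \<longleftrightarrow> integrable circle_measure g \<and>
    (\<forall>A \<in> sets circle_measure.
      (LINT p:A|circle_measure. g p) = (LINT p:T -` A|circle_measure. f p))"

definition transfer_operator ::
    "(circle \<Rightarrow> circle) \<Rightarrow> (circle \<Rightarrow> real) \<Rightarrow> circle \<Rightarrow> real" where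
  "transfer_operator T f = (SOME g. is_pushforward_density T f g)"

lemma C2_circle_map_lift:
  assumes "C2_circle_map T"
  obtains F where "\<And>x. T (circle_proj x) = circle_proj (F x)"
    and "\<And>x. (F has_real_derivative circle_deriv T (circle_proj x)) (at x)"
proof -
  define d where "d x = circle_deriv T (circle_proj x)" for x
  have der: "has_circle_deriv T (d x) (circle_proj x)" for x
    using assms circle_deriv_eq unfolding C2_circle_map_def d_def by metis
  have cont: "isCont d x" for x
    using assms unfolding C2_circle_map_def d_def by (metis DERIV_isCont)
  have "\<exists>G. \<forall>x. (G has_vector_derivative d x) (at x)"
    using einterval_antiderivative[of "-\<infinity>" "\<infinity>" d] cont by simp
  then obtain G where G: "(G has_real_derivative d x) (at x)" for x
    by (auto simp: has_real_derivative_iff_has_vector_derivative)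
  define W where "W t = circle_exp (T (circle_proj t)) * cis (- (2 * pi * G t))" for t
  have "(W has_vector_derivative 0) (at x)" for x
  proof -
    have "((\<lambda>t. - (2 * pi * G t)) has_vector_derivative - (2 * pi * d x)) (at x)"
      using G[of x]
      by (auto intro!: derivative_eq_intros simp flip: has_real_derivative_iff_has_vector_derivative)
    moreover note cis_has_vector_derivative
    ultimately have "(cis \<circ> (\<lambda>t. - (2 * pi * G t)) has_vector_derivative
        (- (2 * pi * d x)) *\<^sub>R (\<i> * cis (- (2 * pi * G x)))) (at x)"
      by (intro vector_diff_chain_at)
    from has_vector_derivative_mult[OF has_circle_deriv_imp[OF der] this]
    show ?thesis
      by (simp add: W_def[abs_def] o_def scaleR_conv_of_real algebra_simps)
  qed
  then have "\<exists>c. \<forall>x. W x = c"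
    by (metis UNIV_I has_vector_derivative_zero_constant convex_UNIV)
  then obtain c where c: "W x = c" for x
    by blast
  obtain y where y: "T (circle_proj 0) = circle_proj y"
    using circle_proj_surj by blast
  have c_eq: "c = cis (2 * pi * (y - G 0))"
    using c[of 0] by (simp add: W_def y circle_exp_proj cis_mult algebra_simps)
  have "circle_exp (T (circle_proj x)) = circle_exp (circle_proj (G x + (y - G 0)))" for x
  proof -
    have "circle_exp (T (circle_proj x)) = W x * cis (2 * pi * G x)"
      by (simp add: W_def mult.assoc cis_mult)
    then show ?thesis
      by (simp add: c c_eq cis_mult circle_exp_proj algebra_simps)
  qed
  then have "T (circle_proj x) = circle_proj (G x + (y - G 0))" for x
    by (simp add: circle_exp_eq_iff)
  moreover have "((\<lambda>x. G x + (y - G 0)) has_real_derivative d x) (at x)" for x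
    using G[of x] by (auto intro!: derivative_eq_intros)
  ultimately show ?thesis
    by (intro that[of "\<lambda>x. G x + (y - G 0)"]) (simp_all add: d_def)
qed

lemma C2_circle_map_measurable:
  assumes "C2_circle_map T"
  shows "T \<in> borel_measurable borel"
proof -
  obtain F where F: "\<And>x. T (circle_proj x) = circle_proj (F x)"
    and dF: "\<And>x. (F has_real_derivative circle_deriv T (circle_proj x)) (at x)"
    using C2_circle_map_lift[OF assms] by metis
  have contF: "continuous_on UNIV F"
    by (meson DERIV_isCont continuous_at_imp_continuous_on dF)
  have "open (T -` U)" if "open U" for U
  proof -
    have "circle_proj -` (T -` U) = F -` (circle_proj -` U)"
      by (auto simp: F)
    then show ?thesis
      using that contF by (simp add: open_circle_def continuous_on_open_vimage)
  qed
  then have "continuous_on UNIV T"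
    by (auto simp: continuous_on_open_vimage)
  then show ?thesis
    by (rule borel_measurable_continuous_onI)
qed

lemma null_sets_circle_measure:
  "N \<in> null_sets circle_measure \<longleftrightarrow> N \<in> sets borel \<and> circle_proj -` N \<in> null_sets lborel"
proof -
  have *: "N \<in> null_sets circle_measure \<longleftrightarrow> {0..<1} \<inter> circle_proj -` N \<in> null_sets lborel"
    if [measurable]: "N \<in> sets borel"
  proof -
    have "circle_proj -` N \<in> sets borel"
      using measurable_sets_borel[OF circle_proj_measurable that] .
    then show ?thesis
      using that
      by (auto simp: circle_measure_def null_sets_def emeasure_distr divide_ennreal_def)
  qed
  have "circle_proj -` N \<in> null_sets lborel"
    if "N \<in> sets borel" "{0..<1} \<inter> circle_proj -` N \<in> null_sets lborel" (is "?B \<in> _") for N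
  proof -
    have "circle_proj -` N = (\<Union>n::int. {x. x - of_int n \<in> ?B})"
    proof (intro equalityI subsetI)
      fix x
      assume "x \<in> circle_proj -` N"
      then have "circle_proj x \<in> N"
        by simp
      moreover have "circle_proj (frac x) = circle_proj x"
        by (simp add: circle_proj_eq_iff frac_def)
      ultimately have "x - of_int \<lfloor>x\<rfloor> \<in> ?B"
        by (simp add: frac_def[symmetric] frac_lt_1)
      then show "x \<in> (\<Union>n::int. {x. x - of_int n \<in> ?B})"
        by blast
    next
      fix x
      assume "x \<in> (\<Union>n::int. {x. x - of_int n \<in> ?B})"
      then obtain n :: int where "circle_proj (x - of_int n) \<in> N"
        by auto
      moreover have "circle_proj (x - of_int n) = circle_proj x"
        by (simp add: circle_proj_eq_iff)
      ultimately show "x \<in> circle_proj -` N"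
        by simp
    qed
    also have "\<dots> \<in> null_sets lborel"
      using that(2) by (intro null_sets_UN null_sets_translation)
    finally show ?thesis .
  qed
  moreover have "{0..<1} \<inter> circle_proj -` N \<in> null_sets lborel"
    if "circle_proj -` N \<in> null_sets lborel"
    using that by (intro null_set_Int1) auto
  moreover have "N \<in> sets borel" if "N \<in> null_sets circle_measure"
    using null_setsD2[OF that] by simp
  ultimately show ?thesis
    using * by blast
qed

lemma expanding_map_nonsingular:
  assumes "expanding_map T" and N: "N \<in> null_sets circle_measure"
  shows "T -` N \<in> null_sets circle_measure"
proof -
  have C2: "C2_circle_map T" and exp: "\<And>p. 1 < \<bar>circle_deriv T p\<bar>"
    using assms by (auto simp: expanding_map_def)
  obtain F where F: "\<And>x. T (circle_proj x) = circle_proj (F x)"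
    and dF: "\<And>x. (F has_real_derivative circle_deriv T (circle_proj x)) (at x)"
    using C2_circle_map_lift[OF C2] by metis
  have nz: "circle_deriv T p \<noteq> 0" for p
    using exp[of p] by auto
  have contF: "continuous_on UNIV F"
    by (meson DERIV_isCont continuous_at_imp_continuous_on dF)
  have "inj F"
  proof (rule injI, rule ccontr)
    fix x y
    assume "F x = F y" "x \<noteq> y"
    then have "\<exists>a b. a < b \<and> F a = F b"
      by (metis linorder_neqE)
    then obtain a b where "a < b" "F a = F b"
      by blast
    then obtain z where "F b - F a = (b - a) * circle_deriv T (circle_proj z)"
      using MVT2[of a b F "\<lambda>z. circle_deriv T (circle_proj z)"] dF by blast
    then show False
      using \<open>a < b\<close> \<open>F a = F b\<close> nz by simp
  qed
  define H where "H = inv F"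
  have HF: "H (F x) = x" for x
    using \<open>inj F\<close> by (simp add: H_def)
  have dH: "H differentiable at (F x)" for x
  proof -
    have "(H has_derivative (\<lambda>t. t / circle_deriv T (circle_proj x))) (at (F x))"
    proof (rule has_derivative_inverse_strong[OF open_UNIV UNIV_I contF])
      show "(F has_derivative (*) (circle_deriv T (circle_proj x))) (at x)"
        using dF[of x] by (simp add: has_field_derivative_def)
    qed (use HF nz in auto)
    then show ?thesis
      by (auto simp: differentiable_def)
  qed
  have T [measurable]: "T \<in> borel_measurable borel"
    by (rule C2_circle_map_measurable[OF C2])
  have "N \<in> sets borel" and negl: "circle_proj -` N \<in> null_sets lborel"
    using N by (simp_all add: null_sets_circle_measure)
  have TN: "T -` N \<in> sets borel"
    using measurable_sets_borel[OF T \<open>N \<in> sets borel\<close>] .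
  have "negligible (circle_proj -` N)"
    using negl by (simp add: negligible_iff_null_sets null_sets_completionI)
  then have "negligible (circle_proj -` N \<inter> range F)"
    by (rule negligible_subset) auto
  then have "negligible (H ` (circle_proj -` N \<inter> range F))"
    using dH by (intro negligible_differentiable_image_negligible)
      (auto simp: differentiable_on_def intro: differentiable_at_withinI)
  moreover have "H ` (circle_proj -` N \<inter> range F) = circle_proj -` (T -` N)"
  proof -
    have "x \<in> H ` (circle_proj -` N \<inter> range F)" if "circle_proj (F x) \<in> N" for x
      using that HF[of x] by (intro image_eqI[of _ _ "F x"]) auto
    then show ?thesis
      by (auto simp: HF F)
  qed
  ultimately have "negligible (circle_proj -` (T -` N))"
    by simp
  moreover have "circle_proj -` (T -` N) \<in> sets borel"
    using measurable_sets_borel[OF circle_proj_measurable TN] .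
  ultimately show ?thesis
    using TN null_sets_completion_iff[of "circle_proj -` (T -` N)" lborel]
    by (simp add: null_sets_circle_measure negligible_iff_null_sets)
qed

text \<open>The transfer operator of an expanding map is well defined on $L^1$.\<close>

lemma is_pushforward_density_unique:
  assumes "is_pushforward_density T f g" "is_pushforward_density T f g'"
  shows "AE p in circle_measure. g p = g' p"
  using assms by (intro density_unique_real) (auto simp: is_pushforward_density_def)

lemma is_pushforward_density_exists_nonneg:
  assumes T: "expanding_map T" and f: "integrable circle_measure f" and nn: "\<And>p. 0 \<le> f p"
  shows "\<exists>g. is_pushforward_density T f g"
proof -
  interpret finite_measure circle_measure
    by (rule finite_measure_circle_measure)
  let ?m = circle_measure
  have [measurable]: "T \<in> borel_measurable borel" "f \<in> borel_measurable borel"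
    using C2_circle_map_measurable T borel_measurable_integrable[OF f]
    by (auto simp: expanding_map_def)
  define N where "N = distr (density ?m f) ?m T"
  have N: "emeasure N A = (\<integral>\<^sup>+p\<in>T -` A. ennreal (f p) \<partial>?m)" if "A \<in> sets borel" for A
    using that measurable_sets_borel[of T borel A]
    by (simp add: N_def emeasure_distr emeasure_density)
  have "absolutely_continuous ?m N"
    unfolding absolutely_continuous_def
  proof
    fix A
    assume A: "A \<in> null_sets ?m"
    then have "T -` A \<in> null_sets ?m"
      by (rule expanding_map_nonsingular[OF T])
    then have "emeasure N A = 0"
      using A N[of A] null_setsD2[OF A] by (simp add: nn_integral_null_set)
    then show "A \<in> null_sets N"
      using null_setsD2[OF A] by (simp add: N_def null_sets_def)
  qed
  then obtain k where k [measurable]: "k \<in> borel_measurable ?m" and kN: "density ?m k = N"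
    using Radon_Nikodym[of N] by (auto simp: N_def)
  have k_int: "(\<integral>\<^sup>+p\<in>A. k p \<partial>?m) = (\<integral>\<^sup>+p\<in>T -` A. ennreal (f p) \<partial>?m)"
    if "A \<in> sets borel" for A
    using that N[OF that] by (simp add: emeasure_density flip: kN)
  have "(\<integral>\<^sup>+p. k p \<partial>?m) = (\<integral>\<^sup>+p. ennreal (f p) \<partial>?m)"
    using k_int[of UNIV] by simp
  also have "\<dots> < \<infinity>"
    using f nn by (simp add: nn_integral_eq_integral)
  finally have fin: "(\<integral>\<^sup>+p. k p \<partial>?m) < \<infinity>" .
  then have "AE p in ?m. k p \<noteq> \<infinity>"
    by (intro nn_integral_PInf_AE) auto
  then have k_eq: "AE p in ?m. ennreal (enn2real (k p)) = k p"
    by eventually_elim (simp add: less_top)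
  define g where "g p = enn2real (k p)" for p
  have [measurable]: "g \<in> borel_measurable ?m"
    unfolding g_def by measurable
  have "(\<integral>\<^sup>+p. ennreal (g p) \<partial>?m) = (\<integral>\<^sup>+p. k p \<partial>?m)"
    using k_eq unfolding g_def by (intro nn_integral_cong_AE) auto
  then have g: "integrable ?m g"
    using fin by (intro integrableI_nonneg) (auto simp: g_def)
  have set_eq: "(LINT p:A|?m. h p) = enn2real (\<integral>\<^sup>+p\<in>A. ennreal (h p) \<partial>?m)"
    if "A \<in> sets borel" "h \<in> borel_measurable ?m" "\<And>p. 0 \<le> h p" for A and h :: "circle \<Rightarrow> real"
    using that unfolding set_lebesgue_integral_def
    by (subst integral_eq_nn_integral)
       (auto intro!: arg_cong[where f = enn2real] nn_integral_cong simp: indicator_def)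
  have "(LINT p:A|?m. g p) = (LINT p:T -` A|?m. f p)" if A: "A \<in> sets borel" for A
  proof -
    have "(\<integral>\<^sup>+p\<in>A. ennreal (g p) \<partial>?m) = (\<integral>\<^sup>+p\<in>A. k p \<partial>?m)"
      using k_eq unfolding g_def by (intro nn_integral_cong_AE) auto
    then show ?thesis
      using A measurable_sets_borel[of T borel A] nn
      by (simp add: set_eq k_int) (simp add: set_eq k_int g_def)
  qed
  then show ?thesis
    using g by (auto simp: is_pushforward_density_def)
qed

lemma is_pushforward_density_transfer_operator:
  assumes T: "expanding_map T" and f: "integrable circle_measure f"
  shows "is_pushforward_density T f (transfer_operator T f)"
proof -
  let ?m = circle_measure
  let ?p = "\<lambda>p. max 0 (f p)" and ?n = "\<lambda>p. max 0 (- f p)"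
  have p: "integrable ?m ?p" and n: "integrable ?m ?n"
    using f by auto
  obtain g h where g: "is_pushforward_density T ?p g" and h: "is_pushforward_density T ?n h"
    using is_pushforward_density_exists_nonneg[OF T p] is_pushforward_density_exists_nonneg[OF T n]
    by auto
  have [measurable]: "T \<in> borel_measurable borel"
    using C2_circle_map_measurable T by (auto simp: expanding_map_def)
  have set_int: "set_integrable ?m A u" if "integrable ?m u" "A \<in> sets borel"
    for A and u :: "circle \<Rightarrow> real"
    using that unfolding set_integrable_def by (intro integrable_mult_indicator) auto
  have "is_pushforward_density T f (\<lambda>p. g p - h p)"
    unfolding is_pushforward_density_def
  proof (intro conjI ballI)
    show "integrable ?m (\<lambda>p. g p - h p)"
      using g h by (auto simp: is_pushforward_density_def)
    fix A
    assume "A \<in> sets ?m"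
    then have A: "A \<in> sets borel" and TA: "T -` A \<in> sets borel"
      using measurable_sets_borel[of T borel A] by auto
    have "(LINT p:A|?m. g p - h p) = (LINT p:T -` A|?m. ?p p) - (LINT p:T -` A|?m. ?n p)"
      using g h A by (subst set_integral_diff) (auto simp: is_pushforward_density_def set_int)
    also have "\<dots> = (LINT p:T -` A|?m. ?p p - ?n p)"
      using TA p n by (subst set_integral_diff) (auto simp: set_int)
    also have "(\<lambda>p. ?p p - ?n p) = f"
      by (auto simp: max_def)
    finally show "(LINT p:A|?m. g p - h p) = (LINT p:T -` A|?m. f p)" .
  qed
  then show ?thesis
    unfolding transfer_operator_def by (rule someI[where P = "is_pushforward_density T f"])
qed

end

theory Submission
  imports Defs
begin

text \<open>
  The densities \<open>L\<^sup>n 1\<close> of the pushforwards of Lebesgue measure under the iterates of \<open>T\<close> are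
  bounded uniformly in \<open>n\<close>, and any nonsingular system with this property has an invariant
  density.

  The uniform bound (\<open>expanding_map_iterates_bounded\<close>) says that the preimage of \<open>A\<close> under
  \<open>T ^^ n\<close> has at most \<open>K\<close> times the measure of \<open>A\<close>. Let \<open>F\<close> be a lift of \<open>T\<close> to the real line.
  Cut a period into intervals that \<open>F ^^ n\<close> stretches to length one. On each of them the
  ratio of two values of the derivative of \<open>F ^^ n\<close> is at most \<open>K\<close>, independently of \<open>n\<close>
  (\<open>expanding_iterate_distortion\<close>): the logarithm of \<open>\<bar>F'\<bar>\<close> is Lipschitz, and the distances between
  the two orbits grow at least geometrically up to a final distance of at most one. So the
  preimage of \<open>A\<close> fills at most the fraction \<open>K\<close> times the measure of \<open>A\<close> of each interval
  (\<open>emeasure_vimage_periodic\<close>).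

  The invariant density is then a multiple of \<open>h = limsup L\<^sup>n 1\<close>
  (\<open>invariant_density_if_bounded_iterates\<close>). Positivity of \<open>L\<close> gives \<open>L h \<ge> h\<close>, and the two sides
  have the same finite integral, so they agree almost everywhere.
\<close>

section \<open>Invariant densities from uniformly bounded iterates\<close>

text \<open>
  The integrals may be infinite, so comparing them over the set \<open>{g < f}\<close> alone gives no
  contradiction. Instead, the hypothesis forces \<open>max f g\<close> and \<open>g\<close> to be densities of the same
  measure, and densities with respect to a \<open>\<sigma>\<close>-finite measure are unique.
\<close>
lemma (in sigma_finite_measure) AE_le_if_set_nn_integral_le:
  fixes f g :: "'a \<Rightarrow> ennreal"
  assumes [measurable]: "f \<in> borel_measurable M" "g \<in> borel_measurable M"
    and le: "\<And>A. A \<in> sets M \<Longrightarrow> (\<integral>\<^sup>+x\<in>A. f x \<partial>M) \<le> (\<integral>\<^sup>+x\<in>A. g x \<partial>M)"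
  shows "AE x in M. f x \<le> g x"
proof -
  define E where "E = {x \<in> space M. g x < f x}"
  have [measurable]: "E \<in> sets M"
    unfolding E_def by measurable
  have "density M (\<lambda>x. max (f x) (g x)) = density M g"
  proof (rule measure_eqI)
    fix A assume "A \<in> sets (density M (\<lambda>x. max (f x) (g x)))"
    then have A [measurable]: "A \<in> sets M"
      by simp
    have split: "(\<integral>\<^sup>+x\<in>A. u x \<partial>M) = (\<integral>\<^sup>+x\<in>A \<inter> E. u x \<partial>M) + (\<integral>\<^sup>+x\<in>A - E. u x \<partial>M)"
      if [measurable]: "u \<in> borel_measurable M" for u :: "'a \<Rightarrow> ennreal"
      by (subst nn_integral_add[symmetric])
         (auto intro!: nn_integral_cong split: split_indicator)
    have "(\<integral>\<^sup>+x\<in>A. max (f x) (g x) \<partial>M) = (\<integral>\<^sup>+x\<in>A \<inter> E. f x \<partial>M) + (\<integral>\<^sup>+x\<in>A - E. g x \<partial>M)"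
      by (subst split)
         (auto intro!: arg_cong2[where f = "(+)"] nn_integral_cong
           simp: E_def max_def split: split_indicator)
    also have "\<dots> \<le> (\<integral>\<^sup>+x\<in>A. g x \<partial>M)"
      by (subst split[of g]) (auto intro!: add_mono le)
    finally show "emeasure (density M (\<lambda>x. max (f x) (g x))) A = emeasure (density M g) A"
      by (auto intro!: antisym nn_integral_mono mult_right_mono simp: emeasure_density)
  qed auto
  then have "AE x in M. max (f x) (g x) = g x"
    by (intro density_unique) auto
  then show ?thesis
    by eventually_elim (metis max.cobounded1)
qed

text \<open>
  Let \<open>P\<close> be the operator that sends a density to the density of its pushforward under \<open>T\<close>, and
  let \<open>f n = P\<^sup>n 1\<close>. The hypothesis says that every \<open>f n\<close> is at most \<open>C\<close>. The
  invariant density is \<open>h = limsup f n\<close>: positivity of \<open>P\<close> gives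
  \<open>P (sup\<^bsub>n \<ge> N\<^esub> f n) \<ge> sup\<^bsub>n > N\<^esub> f n\<close>, hence
  \<open>P h \<ge> h\<close> in the limit by dominated convergence, and since \<open>P\<close> preserves the total
  integral, \<open>P h = h\<close>. The bound \<open>C\<close> also prevents mass from escaping, so \<open>h\<close> is not zero. Using
  the upper limit in place of averages makes a compactness argument superfluous.
\<close>
theorem (in finite_measure) invariant_density_if_bounded_iterates:
  fixes C :: real
  assumes T [measurable]: "T \<in> measurable M M"
    and nonzero: "emeasure M (space M) \<noteq> 0"
    and bound: "\<And>n A. A \<in> sets M \<Longrightarrow> emeasure M ((T ^^ n) -` A \<inter> space M) \<le> C * emeasure M A"
  shows "\<exists>h :: 'a \<Rightarrow> real. integrable M h \<and> (\<forall>x. 0 \<le> h x) \<and> (LINT x|M. h x) = 1 \<and>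
    (\<forall>A \<in> sets M. (LINT x:A|M. h x) = (LINT x:T -` A \<inter> space M|M. h x))"
proof -
  have [measurable]: "T ^^ n \<in> measurable M M" for n
    by (induction n) (auto simp: id_def intro: measurable_comp[OF _ T])
  have Tsp: "T x \<in> space M" if "x \<in> space M" for x
    using that measurable_space[OF T] by blast
  have TA [measurable]: "T -` A \<inter> space M \<in> sets M" if "A \<in> sets M" for A
    using that by measurable
  have "\<exists>f \<in> borel_measurable M. density M f = distr M M (T ^^ n)" for n
  proof (rule Radon_Nikodym)
    show "absolutely_continuous M (distr M M (T ^^ n))"
      unfolding absolutely_continuous_def
    proof
      fix A assume A: "A \<in> null_sets M"
      then show "A \<in> null_sets (distr M M (T ^^ n))"
        using bound[of A n] by (auto simp: null_sets_def emeasure_distr)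
    qed
  qed simp
  then obtain f where f [measurable]: "\<And>n. f n \<in> borel_measurable M"
    and f_density: "\<And>n. density M (f n) = distr M M (T ^^ n)"
    by metis
  have f_int: "(\<integral>\<^sup>+x\<in>A. f n x \<partial>M) = emeasure M ((T ^^ n) -` A \<inter> space M)" if "A \<in> sets M" for A n
    using that arg_cong[OF f_density[of n], of "\<lambda>N. emeasure N A"]
    by (simp add: emeasure_density emeasure_distr)
  define g where "g N x = (SUP n\<in>{N..}. f n x)" for N x
  define h where "h x = (INF N. g N x)" for x
  have [measurable]: "g N \<in> borel_measurable M" for N
    unfolding g_def by measurable
  have [measurable]: "h \<in> borel_measurable M"
    unfolding h_def by measurable
  have f_le_g: "f n x \<le> g N x" if "N \<le> n" for n N x
    using that unfolding g_def by (intro SUP_upper) auto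
  have "AE x in M. f n x \<le> ennreal C" for n
    using bound by (intro AE_le_if_set_nn_integral_le) (auto simp: f_int nn_integral_cmult_indicator)
  then have "AE x in M. \<forall>n. f n x \<le> ennreal C"
    by (simp add: AE_all_countable)
  then have g_le: "AE x in M. g N x \<le> ennreal C" for N
    by eventually_elim (auto simp: g_def intro: SUP_least)
  have g_fin: "(\<integral>\<^sup>+x\<in>A. g N x \<partial>M) < \<infinity>" for A N
  proof -
    have "(\<integral>\<^sup>+x\<in>A. g N x \<partial>M) \<le> (\<integral>\<^sup>+x. ennreal C \<partial>M)"
      using g_le[of N]
      by (intro nn_integral_mono_AE) (auto elim!: eventually_mono split: split_indicator)
    also have "\<dots> < \<infinity>"
      by (simp add: ennreal_mult_less_top ennreal_mult_eq_top_iff less_top[symmetric])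
    finally show ?thesis .
  qed
  have g_mono: "g (Suc N) x \<le> g N x" for N x
    unfolding g_def by (intro SUP_subset_mono) auto
  have h_int: "(\<integral>\<^sup>+x\<in>A. h x \<partial>M) = (INF N. \<integral>\<^sup>+x\<in>A. g N x \<partial>M)" if [measurable]: "A \<in> sets M" for A
  proof -
    have "(\<integral>\<^sup>+x\<in>A. h x \<partial>M) = (\<integral>\<^sup>+x. (INF N. g N x * indicator A x) \<partial>M)"
      unfolding h_def by (auto intro!: nn_integral_cong split: split_indicator)
    also have "\<dots> = (INF N. \<integral>\<^sup>+x\<in>A. g N x \<partial>M)"
      using g_mono g_fin
      by (intro nn_integral_monotone_convergence_INF_AE'[of "\<lambda>N x. g N x * indicator A x"])
        (auto intro!: mult_right_mono AE_I2)
    finally show ?thesis .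
  qed
  \<comment> \<open>This is the inequality \<open>g (Suc N) \<le> P (g N)\<close>, integrated over \<open>A\<close>. The supremum cannot be
    handled set by set, so a density \<open>k\<close> of \<open>P (g N)\<close> is compared with each \<open>f (Suc n)\<close> pointwise.\<close>
  have step: "(\<integral>\<^sup>+x\<in>A. g (Suc N) x \<partial>M) \<le> (\<integral>\<^sup>+x\<in>T -` A \<inter> space M. g N x \<partial>M)"
    if A: "A \<in> sets M" for A N
  proof -
    have push: "emeasure (distr (density M (g N)) M T) B = (\<integral>\<^sup>+x\<in>T -` B \<inter> space M. g N x \<partial>M)"
      if "B \<in> sets M" for B
      using that by (simp add: emeasure_distr emeasure_density)
    have "absolutely_continuous M (distr (density M (g N)) M T)"
      unfolding absolutely_continuous_def
    proof
      fix B assume B: "B \<in> null_sets M"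
      then have "T -` B \<inter> space M \<in> null_sets M"
        using bound[of B 1] by (auto simp: null_sets_def)
      then show "B \<in> null_sets (distr (density M (g N)) M T)"
        using B push[of B] by (auto simp: nn_integral_null_set null_sets_def)
    qed
    then obtain k where k [measurable]: "k \<in> borel_measurable M"
      and k_density: "density M k = distr (density M (g N)) M T"
      using Radon_Nikodym[of "distr (density M (g N)) M T"] by auto
    have k_int: "(\<integral>\<^sup>+x\<in>B. k x \<partial>M) = (\<integral>\<^sup>+x\<in>T -` B \<inter> space M. g N x \<partial>M)" if "B \<in> sets M" for B
      using that push[OF that] by (simp add: emeasure_density flip: k_density)
    have "AE x in M. f (Suc n) x \<le> k x" if "N \<le> n" for n
    proof (rule AE_le_if_set_nn_integral_le)
      fix B assume B: "B \<in> sets M"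
      have "(T ^^ n) -` (T -` B \<inter> space M) \<inter> space M = (T ^^ Suc n) -` B \<inter> space M"
        using measurable_space[of "T ^^ n" M M] by (auto simp: funpow_swap1)
      then have "(\<integral>\<^sup>+x\<in>B. f (Suc n) x \<partial>M) = (\<integral>\<^sup>+x\<in>T -` B \<inter> space M. f n x \<partial>M)"
        using B by (simp add: f_int)
      also have "\<dots> \<le> (\<integral>\<^sup>+x\<in>T -` B \<inter> space M. g N x \<partial>M)"
        using that by (intro nn_integral_mono mult_right_mono f_le_g) auto
      finally show "(\<integral>\<^sup>+x\<in>B. f (Suc n) x \<partial>M) \<le> (\<integral>\<^sup>+x\<in>B. k x \<partial>M)"
        by (simp add: k_int[OF B])
    qed auto
    then have "AE x in M. \<forall>n. N \<le> n \<longrightarrow> f (Suc n) x \<le> k x"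
      by (simp add: AE_all_countable)
    then have "AE x in M. g (Suc N) x \<le> k x"
      unfolding g_def
      by eventually_elim (rule SUP_least, metis atLeast_iff Suc_le_D Suc_le_mono)
    then have "(\<integral>\<^sup>+x\<in>A. g (Suc N) x \<partial>M) \<le> (\<integral>\<^sup>+x\<in>A. k x \<partial>M)"
      by (intro nn_integral_mono_AE) (auto elim!: eventually_mono intro: mult_right_mono)
    then show ?thesis
      by (simp add: k_int[OF A])
  qed
  have h_sub: "(\<integral>\<^sup>+x\<in>A. h x \<partial>M) \<le> (\<integral>\<^sup>+x\<in>T -` A \<inter> space M. h x \<partial>M)" if A: "A \<in> sets M" for A
    unfolding h_int[OF TA[OF A]]
  proof (rule INF_greatest)
    fix N
    have "(\<integral>\<^sup>+x\<in>A. h x \<partial>M) \<le> (\<integral>\<^sup>+x\<in>A. g (Suc N) x \<partial>M)"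
      unfolding h_def by (intro nn_integral_mono mult_right_mono INF_lower) auto
    also note step[OF A]
    finally show "(\<integral>\<^sup>+x\<in>A. h x \<partial>M) \<le> (\<integral>\<^sup>+x\<in>T -` A \<inter> space M. g N x \<partial>M)" .
  qed
  have h_fin: "(\<integral>\<^sup>+x\<in>A. h x \<partial>M) < \<infinity>" if "A \<in> sets M" for A
    using that g_fin[of 0 A] unfolding h_int[OF that] by (auto simp: INF_less_iff)
  \<comment> \<open>Both sides of \<open>h_sub\<close> for \<open>A\<close> and for its complement add up to the same finite total, so
    neither inequality can be strict.\<close>
  have h_inv: "(\<integral>\<^sup>+x\<in>A. h x \<partial>M) = (\<integral>\<^sup>+x\<in>T -` A \<inter> space M. h x \<partial>M)" if A [measurable]: "A \<in> sets M" for A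
  proof (rule antisym[OF h_sub[OF A]])
    have split: "(\<integral>\<^sup>+x. h x \<partial>M) = (\<integral>\<^sup>+x\<in>B. h x \<partial>M) + (\<integral>\<^sup>+x\<in>space M - B. h x \<partial>M)"
      if [measurable]: "B \<in> sets M" for B
      by (subst nn_integral_add[symmetric])
         (auto intro!: nn_integral_cong split: split_indicator)
    have compl: "T -` (space M - A) \<inter> space M = space M - (T -` A \<inter> space M)"
      using Tsp by auto
    have "(\<integral>\<^sup>+x\<in>T -` A \<inter> space M. h x \<partial>M) + (\<integral>\<^sup>+x\<in>space M - A. h x \<partial>M)
        \<le> (\<integral>\<^sup>+x\<in>T -` A \<inter> space M. h x \<partial>M) + (\<integral>\<^sup>+x\<in>space M - (T -` A \<inter> space M). h x \<partial>M)"
      using h_sub[of "space M - A"] A unfolding compl by (intro add_left_mono) auto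
    also have "\<dots> = (\<integral>\<^sup>+x\<in>A. h x \<partial>M) + (\<integral>\<^sup>+x\<in>space M - A. h x \<partial>M)"
      using split[OF A] split[OF TA[OF A]] by simp
    finally show "(\<integral>\<^sup>+x\<in>T -` A \<inter> space M. h x \<partial>M) \<le> (\<integral>\<^sup>+x\<in>A. h x \<partial>M)"
      using h_fin[of "space M - A"] A by (auto simp: add.commute ennreal_add_left_cancel_le)
  qed
  have vimage_space: "(T ^^ n) -` space M \<inter> space M = space M" for n
    using measurable_space[of "T ^^ n" M M] by auto
  have g_int_ge: "emeasure M (space M) \<le> (\<integral>\<^sup>+x\<in>space M. g N x \<partial>M)" for N
  proof -
    have "emeasure M (space M) = (\<integral>\<^sup>+x\<in>space M. f N x \<partial>M)"
      by (simp only: f_int[OF sets.top] vimage_space)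
    also have "\<dots> \<le> (\<integral>\<^sup>+x\<in>space M. g N x \<partial>M)"
      by (intro nn_integral_mono mult_right_mono f_le_g) auto
    finally show ?thesis .
  qed
  define c where "c = enn2real (\<integral>\<^sup>+x. h x \<partial>M)"
  have space_int: "(\<integral>\<^sup>+x. u x \<partial>M) = (\<integral>\<^sup>+x\<in>space M. u x \<partial>M)" for u :: "'a \<Rightarrow> ennreal"
    by (auto intro!: nn_integral_cong)
  have c: "(\<integral>\<^sup>+x. h x \<partial>M) = ennreal c"
    using h_fin[OF sets.top] by (simp add: c_def less_top)
  have "emeasure M (space M) \<le> (\<integral>\<^sup>+x. h x \<partial>M)"
    unfolding space_int[of h] h_int[OF sets.top] by (intro INF_greatest g_int_ge)
  then have "c > 0"
    using nonzero c by (metis ennreal_eq_0_iff le_zero_eq not_le)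
  define r where "r x = enn2real (h x) / c" for x
  have r_nonneg: "0 \<le> r x" for x
    using \<open>c > 0\<close> by (simp add: r_def)
  have [measurable]: "r \<in> borel_measurable M"
    unfolding r_def by measurable
  have "AE x in M. h x \<noteq> \<infinity>"
    using c by (intro nn_integral_PInf_AE) auto
  then have r_eq: "AE x in M. ennreal (r x) = h x / ennreal c"
    by eventually_elim (use \<open>c > 0\<close> in \<open>simp add: r_def less_top flip: divide_ennreal\<close>)
  have r_int: "(\<integral>\<^sup>+x\<in>A. ennreal (r x) \<partial>M) = (\<integral>\<^sup>+x\<in>A. h x \<partial>M) / ennreal c" if [measurable]: "A \<in> sets M" for A
  proof -
    have "(\<integral>\<^sup>+x\<in>A. ennreal (r x) \<partial>M) = (\<integral>\<^sup>+x. (h x * indicator A x) / ennreal c \<partial>M)"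
      using r_eq by (intro nn_integral_cong_AE) (auto elim!: eventually_mono split: split_indicator)
    also have "\<dots> = (\<integral>\<^sup>+x\<in>A. h x \<partial>M) / ennreal c"
      by (intro nn_integral_divide) auto
    finally show ?thesis .
  qed
  have r_total: "(\<integral>\<^sup>+x. ennreal (r x) \<partial>M) = 1"
    using r_int[OF sets.top] \<open>c > 0\<close> by (simp add: c divide_ennreal)
  have set_eq: "(LINT x:A|M. r x) = enn2real (\<integral>\<^sup>+x\<in>A. ennreal (r x) \<partial>M)" if "A \<in> sets M" for A
    using that r_nonneg unfolding set_lebesgue_integral_def
    by (subst integral_eq_nn_integral)
       (auto intro!: arg_cong[where f = enn2real] nn_integral_cong simp: indicator_def)
  show ?thesis
  proof (intro exI conjI allI ballI)
    show "integrable M r"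
      using r_nonneg r_total by (intro integrableI_nonneg) auto
    show "(LINT x|M. r x) = 1"
      using r_nonneg r_total by (subst integral_eq_nn_integral) auto
    show "(LINT x:A|M. r x) = (LINT x:T -` A \<inter> space M|M. r x)" if "A \<in> sets M" for A
      using that h_inv[OF that] by (simp add: set_eq r_int)
  qed (rule r_nonneg)
qed

section \<open>Preimages of periodic sets under maps of bounded distortion\<close>

definition one_periodic :: "real set \<Rightarrow> bool" where
  "one_periodic B \<longleftrightarrow> (\<forall>x (k :: int). x + of_int k \<in> B \<longleftrightarrow> x \<in> B)"

lemma emeasure_one_periodic:
  assumes B: "one_periodic B" and [measurable]: "B \<in> sets borel"
  shows "emeasure lborel (B \<inter> {v..v + 1}) = emeasure lborel (B \<inter> {0..<1})"
proof -
  define k where "k = \<lfloor>v\<rfloor>"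
  define s where "s = v - of_int k"
  have s: "0 \<le> s" "s < 1" and v: "v = s + of_int k"
    unfolding s_def k_def by linarith+
  have shift: "emeasure lborel (B \<inter> {a + of_int j..<b + of_int j}) = emeasure lborel (B \<inter> {a..<b})"
    for a b and j :: int
  proof -
    have "emeasure lborel (B \<inter> {a + of_int j..<b + of_int j})
        = emeasure (distr lborel borel (\<lambda>x. of_int j + x)) (B \<inter> {a + of_int j..<b + of_int j})"
      by (simp add: lborel_distr_plus)
    also have "\<dots> = emeasure lborel ((\<lambda>x. of_int j + x) -` (B \<inter> {a + of_int j..<b + of_int j}))"
      by (subst emeasure_distr) auto
    also have "(\<lambda>x. of_int j + x) -` (B \<inter> {a + of_int j..<b + of_int j}) = B \<inter> {a..<b}"
      using B by (auto simp: one_periodic_def add.commute)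
    finally show ?thesis .
  qed
  have split: "emeasure lborel (B \<inter> {a..<c})
      = emeasure lborel (B \<inter> {a..<b}) + emeasure lborel (B \<inter> {b..<c})" if "a \<le> b" "b \<le> c" for a b c
    using that by (subst plus_emeasure) (auto intro!: arg_cong2[where f = emeasure])
  have "emeasure lborel (B \<inter> {v..v + 1}) = emeasure lborel (B \<inter> {v..<v + 1})"
  proof (rule emeasure_eq_AE)
    show "AE x in lborel. x \<in> B \<inter> {v..v + 1} \<longleftrightarrow> x \<in> B \<inter> {v..<v + 1}"
      using AE_lborel_singleton[of "v + 1"] by eventually_elim auto
  qed auto
  also have "\<dots> = emeasure lborel (B \<inter> {s..<s + 1})"
    using shift[of s k "s + 1"] by (simp add: v algebra_simps)
  also have "\<dots> = emeasure lborel (B \<inter> {s..<1}) + emeasure lborel (B \<inter> {1..<s + 1})"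
    using s by (intro split) auto
  also have "emeasure lborel (B \<inter> {1..<s + 1}) = emeasure lborel (B \<inter> {0..<s})"
    using shift[of 0 1 s] by simp
  also have "emeasure lborel (B \<inter> {s..<1}) + emeasure lborel (B \<inter> {0..<s}) = emeasure lborel (B \<inter> {0..<1})"
    using s by (subst add.commute, intro split[symmetric]) auto
  finally show ?thesis .
qed

text \<open>
  The substitution \<open>y = G x\<close> costs a factor \<open>G' x\<close>. By the mean value theorem some value of
  \<open>G'\<close> on \<open>[u, w]\<close> is exactly \<open>1 / (w - u)\<close>, so bounded distortion makes every value at least
  \<open>1 / (K * (w - u))\<close>. The factor \<open>w - u\<close> in the conclusion is what makes the sum over many
  such intervals converge to a bound independent of their number.
\<close>
lemma emeasure_vimage_unit_image:
  fixes G G' :: "real \<Rightarrow> real"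
  assumes dG: "\<And>x. (G has_real_derivative G' x) (at x)"
    and cont: "continuous_on UNIV G'"
    and pos: "\<And>x. 0 < G' x"
    and uw: "u < w" "G w = G u + 1"
    and distortion: "\<And>x y. x \<in> {u..w} \<Longrightarrow> y \<in> {u..w} \<Longrightarrow> G' x \<le> K * G' y"
    and [measurable]: "B \<in> sets borel"
  shows "emeasure lborel (G -` B \<inter> {u..w})
    \<le> ennreal (K * (w - u)) * emeasure lborel (B \<inter> {G u..G u + 1})"
proof -
  have [measurable]: "G \<in> borel_measurable borel"
    using dG by (intro borel_measurable_continuous_onI)
      (meson DERIV_isCont continuous_at_imp_continuous_on)
  have [measurable]: "G' \<in> borel_measurable borel"
    using cont by (rule borel_measurable_continuous_onI)
  obtain \<xi> where \<xi>: "u < \<xi>" "\<xi> < w" "G w - G u = (w - u) * G' \<xi>"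
    using MVT2[of u w G G'] uw(1) dG by blast
  have ge: "1 \<le> K * (w - u) * G' x" if "x \<in> {u..w}" for x
  proof -
    have "1 = (w - u) * G' \<xi>"
      using \<xi> uw by simp
    also have "\<dots> \<le> (w - u) * (K * G' x)"
      using distortion[of \<xi> x] \<xi> that uw by (intro mult_left_mono) auto
    finally show ?thesis
      by (simp add: algebra_simps)
  qed
  have "0 < K"
    using distortion[of u u] pos[of u] uw(1) zero_less_mult_pos2[of K "G' u"] by auto
  have "emeasure lborel (G -` B \<inter> {u..w}) = (\<integral>\<^sup>+x. indicator (G -` B \<inter> {u..w}) x \<partial>lborel)"
    by (intro nn_integral_indicator[symmetric]) measurable
  also have "\<dots> \<le> (\<integral>\<^sup>+x. ennreal (K * (w - u)) * ennreal (indicator B (G x) * G' x * indicator {u..w} x) \<partial>lborel)"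
  proof (rule nn_integral_mono)
    fix x
    show "indicator (G -` B \<inter> {u..w}) x
        \<le> ennreal (K * (w - u)) * ennreal (indicator B (G x) * G' x * indicator {u..w} x)"
      using ge[of x] \<open>0 < K\<close> uw pos[of x]
      by (auto simp: indicator_def simp flip: ennreal_mult ennreal_1)
  qed
  also have "\<dots> = ennreal (K * (w - u))
      * (\<integral>\<^sup>+x. ennreal (indicator B (G x) * G' x * indicator {u..w} x) \<partial>lborel)"
    by (intro nn_integral_cmult) auto
  also have "(\<integral>\<^sup>+x. ennreal (indicator B (G x) * G' x * indicator {u..w} x) \<partial>lborel)
      = (\<integral>\<^sup>+x. ennreal (indicator B x * indicator {G u..G w} x) \<partial>lborel)"
    using dG cont pos uw
    by (intro nn_integral_substitution[symmetric])
       (auto simp: set_borel_measurable_def less_imp_le intro: continuous_on_subset)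
  also have "\<dots> = (\<integral>\<^sup>+x. indicator (B \<inter> {G u..G u + 1}) x \<partial>lborel)"
    using uw by (intro nn_integral_cong) (auto split: split_indicator)
  also have "\<dots> = emeasure lborel (B \<inter> {G u..G u + 1})"
    by simp
  finally show ?thesis .
qed

text \<open>
  The points of \<open>[0, 1]\<close> whose images lie at integer distance from \<open>G 0\<close> cut \<open>[0, 1]\<close> into
  intervals with images of length one. Each of them contributes at most \<open>K\<close> times its length
  times the measure of \<open>B\<close> in one period, and the lengths add up to one.
\<close>
lemma emeasure_vimage_periodic_increasing:
  fixes G G' :: "real \<Rightarrow> real" and D :: int
  assumes dG: "\<And>x. (G has_real_derivative G' x) (at x)"
    and cont: "continuous_on UNIV G'"
    and pos: "\<And>x. 0 < G' x"
    and D: "G 1 = G 0 + of_int D"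
    and distortion: "\<And>x y. \<bar>G x - G y\<bar> \<le> 1 \<Longrightarrow> G' x \<le> K * G' y"
    and B: "one_periodic B" and [measurable]: "B \<in> sets borel"
  shows "emeasure lborel (G -` B \<inter> {0..<1}) \<le> ennreal K * emeasure lborel (B \<inter> {0..<1})"
proof -
  have mono: "G x < G y" if "x < y" for x y
    using DERIV_pos_imp_increasing[of x y G] that dG pos by blast
  have mono_iff: "G x \<le> G y \<longleftrightarrow> x \<le> y" "G x < G y \<longleftrightarrow> x < y" for x y
    using mono[of x y] mono[of y x] by (cases x y rule: linorder_cases; simp)+
  have "inj G"
    by (rule injI) (metis mono less_irrefl linorder_less_linear)
  have contG: "continuous_on S G" for S
    using dG by (meson DERIV_isCont continuous_at_imp_continuous_on)
  have [measurable]: "G \<in> borel_measurable borel"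
    by (rule borel_measurable_continuous_onI[OF contG])
  have "0 < K"
    using distortion[of 0 0] pos[of 0] zero_less_mult_pos2[of K "G' 0"] by auto
  define m where "m = nat D"
  have m: "G 1 = G 0 + real m"
    using D mono[of 0 1] by (simp add: m_def)
  have "\<exists>x. 0 \<le> x \<and> x \<le> 1 \<and> G x = G 0 + real j" if "j \<le> m" for j
    using IVT'[of G 0 "G 0 + real j" 1] m that contG by auto
  then obtain u where u: "\<And>j. j \<le> m \<Longrightarrow> 0 \<le> u j \<and> u j \<le> 1 \<and> G (u j) = G 0 + real j"
    by metis
  have u0: "u 0 = 0" and um: "u m = 1"
    using u[of 0] u[of m] m injD[OF \<open>inj G\<close>] by simp_all
  have cover: "{0..<1} \<subseteq> (\<Union>j<m. {u j..u (Suc j)})"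
  proof
    fix x :: real assume x: "x \<in> {0..<1}"
    define j where "j = nat \<lfloor>G x - G 0\<rfloor>"
    have G_bounds: "G 0 \<le> G x" "G x < G 1"
      using x by (simp_all add: mono_iff)
    then have j: "real j \<le> G x - G 0" "G x - G 0 < real j + 1"
      unfolding j_def by linarith+
    then have "j < m"
      using G_bounds m by linarith
    then have "x \<in> {u j..u (Suc j)}"
      using u[of j] u[of "Suc j"] j mono_iff(1)[of "u j" x] mono_iff(1)[of x "u (Suc j)"] by auto
    then show "x \<in> (\<Union>j<m. {u j..u (Suc j)})"
      using \<open>j < m\<close> by blast
  qed
  have piece: "emeasure lborel (G -` B \<inter> {u j..u (Suc j)})
      \<le> ennreal (K * (u (Suc j) - u j)) * emeasure lborel (B \<inter> {0..<1})" if "j < m" for j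
  proof -
    have G_eq: "G (u (Suc j)) = G (u j) + 1"
      using u[of j] u[of "Suc j"] that by simp
    then have "u j < u (Suc j)"
      using mono_iff(2)[of "u j" "u (Suc j)"] by simp
    moreover have "G' x \<le> K * G' y" if "x \<in> {u j..u (Suc j)}" "y \<in> {u j..u (Suc j)}" for x y
    proof (rule distortion)
      have "G z \<in> {G (u j)..G (u j) + 1}" if "z \<in> {u j..u (Suc j)}" for z
        using that mono_iff(1)[of "u j" z] mono_iff(1)[of z "u (Suc j)"] G_eq by simp
      from this[OF that(1)] this[OF that(2)] show "\<bar>G x - G y\<bar> \<le> 1"
        by (simp add: abs_le_iff)
    qed
    ultimately show ?thesis
      using emeasure_vimage_unit_image[OF dG cont pos _ G_eq, of K B] B
      by (simp add: emeasure_one_periodic)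
  qed
  have "emeasure lborel (G -` B \<inter> {0..<1}) \<le> emeasure lborel (\<Union>j<m. G -` B \<inter> {u j..u (Suc j)})"
    using cover by (intro emeasure_mono) auto
  also have "\<dots> \<le> (\<Sum>j<m. emeasure lborel (G -` B \<inter> {u j..u (Suc j)}))"
    by (intro emeasure_subadditive_finite) auto
  also have "\<dots> \<le> (\<Sum>j<m. ennreal (K * (u (Suc j) - u j)) * emeasure lborel (B \<inter> {0..<1}))"
    using piece by (intro sum_mono) auto
  also have "\<dots> = ennreal (\<Sum>j<m. K * (u (Suc j) - u j)) * emeasure lborel (B \<inter> {0..<1})"
  proof -
    have "0 \<le> K * (u (Suc j) - u j)" if "j < m" for j
      using u[of j] u[of "Suc j"] that \<open>0 < K\<close> mono_iff(1)[of "u j" "u (Suc j)"] by simp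
    then show ?thesis
      by (subst sum_ennreal[symmetric]) (auto simp: sum_distrib_right)
  qed
  also have "(\<Sum>j<m. K * (u (Suc j) - u j)) = K"
    by (simp add: sum_lessThan_telescope u0 um flip: sum_distrib_left)
  finally show ?thesis .
qed

text \<open>A decreasing \<open>G\<close> is reduced to the increasing \<open>- G\<close> by reflecting \<open>B\<close> as well.\<close>
lemma emeasure_vimage_periodic:
  fixes G G' :: "real \<Rightarrow> real" and D :: int
  assumes dG: "\<And>x. (G has_real_derivative G' x) (at x)"
    and cont: "continuous_on UNIV G'"
    and nz: "\<And>x. G' x \<noteq> 0"
    and D: "G 1 = G 0 + of_int D"
    and distortion: "\<And>x y. \<bar>G x - G y\<bar> \<le> 1 \<Longrightarrow> \<bar>G' x\<bar> \<le> K * \<bar>G' y\<bar>"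
    and B: "one_periodic B" and meas [measurable]: "B \<in> sets borel"
  shows "emeasure lborel (G -` B \<inter> {0..<1}) \<le> ennreal K * emeasure lborel (B \<inter> {0..<1})"
proof -
  have "connected (range G')"
    using cont by (intro connected_continuous_image) auto
  then consider "\<And>x. 0 < G' x" | "\<And>x. G' x < 0"
    using nz by (smt (verit) connected_iff_interval rangeI rangeE)
  then show ?thesis
  proof cases
    case 1
    show ?thesis
      using distortion 1
      by (intro emeasure_vimage_periodic_increasing[OF dG cont 1 D _ B meas]) (simp add: less_imp_le)
  next
    case 2
    have neg: "one_periodic (uminus -` B)"
      using B unfolding one_periodic_def
      by (metis add.inverse_inverse minus_add_distrib of_int_minus vimage_eq)
    have neg_meas: "uminus -` B \<in> sets borel"
      by (rule measurable_sets_borel[OF _ meas]) simp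
    have dnG: "((\<lambda>x. - G x) has_real_derivative - G' x) (at x)" for x
      using dG[of x] by (rule DERIV_minus)
    have "emeasure lborel ((\<lambda>x. - G x) -` (uminus -` B) \<inter> {0..<1})
        \<le> ennreal K * emeasure lborel (uminus -` B \<inter> {0..<1})"
    proof (rule emeasure_vimage_periodic_increasing[OF dnG _ _ _ _ neg neg_meas])
      show "continuous_on UNIV (\<lambda>x. - G' x)"
        using cont by (rule continuous_on_minus)
      show "- G 1 = - G 0 + of_int (- D)"
        using D by simp
      show "- G' x \<le> K * - G' y" if "\<bar>- G x - - G y\<bar> \<le> 1" for x y
        using distortion[of x y] that 2[of x] 2[of y] by (simp add: abs_minus_commute)
    qed (use 2 in simp)
    also have "(\<lambda>x. - G x) -` (uminus -` B) = G -` B"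
      by auto
    also have "emeasure lborel (uminus -` B \<inter> {0..<1}) = emeasure lborel (B \<inter> {0..<1})"
    proof -
      have "emeasure lborel (uminus -` B \<inter> {0..<1}) = emeasure lborel (uminus -` B \<inter> {0..0 + 1})"
        by (simp only: emeasure_one_periodic[OF neg neg_meas])
      also have "uminus -` B \<inter> {0..0 + 1} = uminus -` (B \<inter> {-1..-1 + 1 :: real})"
        by auto
      also have "emeasure lborel \<dots> = emeasure (distr lborel borel uminus) (B \<inter> {-1..-1 + 1})"
        by (subst emeasure_distr) auto
      also have "\<dots> = emeasure lborel (B \<inter> {0..<1})"
        by (simp only: lborel_distr_uminus emeasure_one_periodic[OF B meas])
      finally show ?thesis .
    qed
    finally show ?thesis .
  qed
qed

section \<open>Bounded distortion of iterated expanding maps\<close>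

text \<open>
  Bounded distortion: the factors in the derivatives of \<open>F ^^ n\<close> at two points differ by the
  factors \<open>exp (M * \<bar>(F ^^ k) x - (F ^^ k) y\<bar>)\<close>, and expansion makes these distances, counted
  backwards from \<open>n\<close>, decay geometrically with ratio \<open>1 / \<rho>\<close>. So the total exponent is controlled
  by the last distance alone, uniformly in \<open>n\<close>. The constant \<open>c = M / (\<rho> - 1)\<close> is the solution
  of \<open>c + M = \<rho> * c\<close>, which is what the induction step requires.
\<close>
lemma expanding_iterate_distortion:
  fixes F d :: "real \<Rightarrow> real"
  assumes expand: "\<And>x y. \<rho> * \<bar>x - y\<bar> \<le> \<bar>F x - F y\<bar>" and "1 < \<rho>" and "0 \<le> M"
    and step: "\<And>x y. \<bar>d x\<bar> \<le> exp (M * \<bar>x - y\<bar>) * \<bar>d y\<bar>"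
  shows "\<bar>\<Prod>k<n. d ((F ^^ k) x)\<bar>
    \<le> exp (M / (\<rho> - 1) * \<bar>(F ^^ n) x - (F ^^ n) y\<bar>) * \<bar>\<Prod>k<n. d ((F ^^ k) y)\<bar>"
proof (induction n)
  case (Suc n)
  define c where "c = M / (\<rho> - 1)"
  define a where "a = \<bar>(F ^^ n) x - (F ^^ n) y\<bar>"
  define b where "b = \<bar>(F ^^ Suc n) x - (F ^^ Suc n) y\<bar>"
  have "0 \<le> c" and c: "c + M = \<rho> * c"
    using \<open>1 < \<rho>\<close> \<open>0 \<le> M\<close> by (auto simp: c_def field_simps)
  have "c * a + M * a = c * (\<rho> * a)"
    using c by (metis distrib_right mult.assoc mult.commute)
  also have "\<dots> \<le> c * b"
    using expand[of "(F ^^ n) x" "(F ^^ n) y"] \<open>0 \<le> c\<close> by (intro mult_left_mono) (auto simp: a_def b_def)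
  finally have ab: "c * a + M * a \<le> c * b" .
  have "\<bar>\<Prod>k<Suc n. d ((F ^^ k) x)\<bar> = \<bar>\<Prod>k<n. d ((F ^^ k) x)\<bar> * \<bar>d ((F ^^ n) x)\<bar>"
    by (simp add: abs_mult)
  also have "\<dots> \<le> (exp (c * a) * \<bar>\<Prod>k<n. d ((F ^^ k) y)\<bar>) * (exp (M * a) * \<bar>d ((F ^^ n) y)\<bar>)"
    using Suc step unfolding a_def c_def by (intro mult_mono) auto
  also have "\<dots> = exp (c * a + M * a) * \<bar>\<Prod>k<Suc n. d ((F ^^ k) y)\<bar>"
    by (simp add: abs_mult exp_add)
  also have "\<dots> \<le> exp (c * b) * \<bar>\<Prod>k<Suc n. d ((F ^^ k) y)\<bar>"
    using ab by (intro mult_right_mono) auto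
  finally show ?case
    unfolding b_def c_def .
qed (use \<open>1 < \<rho>\<close> \<open>0 \<le> M\<close> in simp)

text \<open>
  For \<open>\<bar>d\<bar> \<ge> 1\<close>, a Lipschitz bound on \<open>d\<close> is a Lipschitz bound on its logarithm; the
  exponential form applies to both signs of \<open>d\<close>.
\<close>
lemma abs_le_exp_mult_abs_if_lipschitz:
  fixes d :: "real \<Rightarrow> real"
  assumes "\<bar>d x - d y\<bar> \<le> M * \<bar>x - y\<bar>" "1 \<le> \<bar>d y\<bar>" "0 \<le> M"
  shows "\<bar>d x\<bar> \<le> exp (M * \<bar>x - y\<bar>) * \<bar>d y\<bar>"
proof -
  have "\<bar>d x\<bar> \<le> \<bar>d y\<bar> + M * \<bar>x - y\<bar>"
    using assms(1) by linarith
  also have "\<dots> \<le> \<bar>d y\<bar> + M * \<bar>x - y\<bar> * \<bar>d y\<bar>"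
    using mult_left_mono[OF assms(2), of "M * \<bar>x - y\<bar>"] assms(3) by simp
  also have "\<dots> = (1 + M * \<bar>x - y\<bar>) * \<bar>d y\<bar>"
    by (simp add: algebra_simps)
  also have "\<dots> \<le> exp (M * \<bar>x - y\<bar>) * \<bar>d y\<bar>"
    by (intro mult_right_mono exp_ge_add_one_self) auto
  finally show ?thesis .
qed

text \<open>
  The derivative \<open>d\<close> of a lift and its own derivative are continuous and 1-periodic, so the
  pointwise condition \<open>\<bar>d\<bar> > 1\<close> becomes uniform and \<open>d\<close> becomes globally Lipschitz, by
  compactness of \<open>[0, 1]\<close>. This is where second-order smoothness enters.
\<close>
lemma expanding_map_lift:
  assumes "expanding_map T"
  obtains F d :: "real \<Rightarrow> real" and \<rho> M :: real
  where "\<And>x. T (circle_proj x) = circle_proj (F x)"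
    and "\<And>x. (F has_real_derivative d x) (at x)" and "continuous_on UNIV d"
    and "1 < \<rho>" and "\<And>x. \<rho> \<le> \<bar>d x\<bar>"
    and "0 \<le> M" and "\<And>x y. \<bar>d x - d y\<bar> \<le> M * \<bar>x - y\<bar>"
proof -
  have C2: "C2_circle_map T" and expand: "\<And>p. 1 < \<bar>circle_deriv T p\<bar>"
    using assms by (auto simp: expanding_map_def)
  define d where "d x = circle_deriv T (circle_proj x)" for x
  obtain F where F: "\<And>x. T (circle_proj x) = circle_proj (F x)"
    and dF: "\<And>x. (F has_real_derivative d x) (at x)"
    using C2_circle_map_lift[OF C2] unfolding d_def by metis
  obtain g where g: "\<And>x. (d has_real_derivative g x) (at x)" and cont_g: "continuous_on UNIV g"
    using C2 unfolding C2_circle_map_def d_def by blast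
  have cont_d: "continuous_on UNIV d"
    using g by (meson DERIV_isCont continuous_at_imp_continuous_on)
  have proj_shift: "circle_proj (x + of_int k) = circle_proj x" for x and k :: int
    by (simp add: circle_proj_eq_iff)
  have d_per: "d (x + of_int k) = d x" for x and k :: int
    by (simp add: d_def proj_shift)
  have g_per: "g (x + of_int k) = g x" for x and k :: int
  proof -
    have "((\<lambda>t. d (t + of_int k)) has_real_derivative g (x + of_int k)) (at x)"
      using g[of "x + of_int k"] by (simp add: DERIV_shift)
    then show ?thesis
      using g[of x] by (simp add: d_per DERIV_unique)
  qed
  have frac: "frac x \<in> {0..1}" "frac x = x + of_int (- \<lfloor>x\<rfloor>)" for x :: real
    using frac_lt_1[of x] by (auto simp: frac_def less_imp_le)
  have "\<exists>x0\<in>{0..1}. \<forall>x\<in>{0..1}. \<bar>d x0\<bar> \<le> \<bar>d x\<bar>"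
    by (intro continuous_attains_inf continuous_on_rabs continuous_on_subset[OF cont_d]) auto
  then obtain x0 where x0: "\<And>x. x \<in> {0..1} \<Longrightarrow> \<bar>d x0\<bar> \<le> \<bar>d x\<bar>"
    by blast
  have d_ge: "\<bar>d x0\<bar> \<le> \<bar>d x\<bar>" for x
    using x0[OF frac(1), of x] unfolding frac(2) d_per .
  have "\<exists>x1\<in>{0..1}. \<forall>x\<in>{0..1}. \<bar>g x\<bar> \<le> \<bar>g x1\<bar>"
    by (intro continuous_attains_sup continuous_on_rabs continuous_on_subset[OF cont_g]) auto
  then obtain x1 where x1: "\<And>x. x \<in> {0..1} \<Longrightarrow> \<bar>g x\<bar> \<le> \<bar>g x1\<bar>"
    by blast
  have g_le: "\<bar>g x\<bar> \<le> \<bar>g x1\<bar>" for x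
    using x1[OF frac(1), of x] unfolding frac(2) g_per .
  have d_lip: "\<bar>d x - d y\<bar> \<le> \<bar>g x1\<bar> * \<bar>x - y\<bar>" for x y
    using field_differentiable_bound[of UNIV d g "\<bar>g x1\<bar>" x y] g g_le by simp
  show ?thesis
    by (rule that[OF F dF cont_d _ d_ge _ d_lip]) (use expand in \<open>auto simp: d_def\<close>)
qed

section \<open>Uniformly bounded densities for iterates of expanding maps\<close>

lemma emeasure_circle_measure:
  assumes "A \<in> sets borel"
  shows "emeasure circle_measure A = emeasure lborel (circle_proj -` A \<inter> {0..<1})"
  using assms measurable_sets_borel[OF circle_proj_measurable assms]
  by (simp add: circle_measure_def emeasure_distr Int_commute divide_ennreal_def)

text \<open>
  Equivalently, the densities \<open>L\<^sup>n 1\<close> are bounded by \<open>K\<close> almost everywhere. The degree of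
  \<open>T ^^ n\<close> grows exponentially with \<open>n\<close>, but so do the derivatives of its branches, and bounded
  distortion balances the two.
\<close>
theorem expanding_map_iterates_bounded:
  assumes "expanding_map T"
  obtains K :: real
  where "\<And>n A. A \<in> sets borel
    \<Longrightarrow> emeasure circle_measure ((T ^^ n) -` A) \<le> ennreal K * emeasure circle_measure A"
proof -
  obtain F d :: "real \<Rightarrow> real" and \<rho> M :: real
    where F: "\<And>x. T (circle_proj x) = circle_proj (F x)"
      and dF: "\<And>x. (F has_real_derivative d x) (at x)" and cont_d: "continuous_on UNIV d"
      and \<rho>: "1 < \<rho>" "\<And>x. \<rho> \<le> \<bar>d x\<bar>"
      and M: "0 \<le> M" "\<And>x y. \<bar>d x - d y\<bar> \<le> M * \<bar>x - y\<bar>"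
    using expanding_map_lift[OF assms] by metis
  have expand: "\<rho> * \<bar>x - y\<bar> \<le> \<bar>F x - F y\<bar>" for x y
  proof -
    have *: "\<rho> * \<bar>a - b\<bar> \<le> \<bar>F a - F b\<bar>" if ab: "a < b" for a b
    proof -
      obtain z where "F b - F a = (b - a) * d z"
        using MVT2[OF ab, of F d] dF by blast
      then have "\<bar>F a - F b\<bar> = \<bar>d z\<bar> * \<bar>a - b\<bar>"
        by (metis abs_minus_commute abs_mult mult.commute)
      then show ?thesis
        using \<rho>(2)[of z] by (simp add: mult_right_mono)
    qed
    show ?thesis
      using *[of x y] *[of y x] by (cases x y rule: linorder_cases) (auto simp: abs_minus_commute)
  qed
  have step: "\<bar>d x\<bar> \<le> exp (M * \<bar>x - y\<bar>) * \<bar>d y\<bar>" for x y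
    using M \<rho>(1) \<rho>(2)[of y] by (intro abs_le_exp_mult_abs_if_lipschitz) auto
  have F_iter: "circle_proj ((F ^^ n) x) = (T ^^ n) (circle_proj x)" for n x
    by (induction n) (auto simp flip: F)
  have dF_iter: "((F ^^ n) has_real_derivative (\<Prod>k<n. d ((F ^^ k) x))) (at x)" for n x
  proof (induction n)
    case (Suc n)
    then show ?case
      using DERIV_chain[OF dF Suc] by (simp add: o_def mult.commute)
  qed (simp add: id_def)
  have cont_iter: "continuous_on UNIV (F ^^ n)" for n
    using dF_iter by (meson DERIV_isCont continuous_at_imp_continuous_on)
  define K where "K = exp (M / (\<rho> - 1))"
  have bound: "emeasure circle_measure ((T ^^ n) -` A) \<le> ennreal K * emeasure circle_measure A"
    if A: "A \<in> sets borel" for n A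
  proof -
    have "T \<in> borel_measurable borel"
      using assms by (auto simp: expanding_map_def intro: C2_circle_map_measurable)
    then have "T ^^ n \<in> borel_measurable borel"
      by (rule measurable_compose_n)
    then have TA: "(T ^^ n) -` A \<in> sets borel"
      using A by (rule measurable_sets_borel)
    define B where "B = circle_proj -` A"
    have B: "B \<in> sets borel"
      unfolding B_def using A by (rule measurable_sets_borel[OF circle_proj_measurable])
    have "circle_proj (x + of_int k) = circle_proj x" for x and k :: int
      by (simp add: circle_proj_eq_iff)
    then have per: "one_periodic B"
      by (simp add: one_periodic_def B_def)
    have "(F ^^ n) 1 - (F ^^ n) 0 \<in> \<int>"
      unfolding circle_proj_eq_iff[symmetric] F_iter
      by (rule arg_cong[where f = "T ^^ n"]) (simp add: circle_proj_eq_iff)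
    then obtain D :: int where D: "(F ^^ n) 1 = (F ^^ n) 0 + of_int D"
      by (metis Ints_cases add.commute diff_add_cancel)
    have "emeasure lborel ((F ^^ n) -` B \<inter> {0..<1}) \<le> ennreal K * emeasure lborel (B \<inter> {0..<1})"
    proof (rule emeasure_vimage_periodic[OF dF_iter _ _ D _ per B])
      have "continuous_on UNIV (\<lambda>x. d ((F ^^ k) x))" for k
        using continuous_on_compose2[OF cont_d cont_iter] by simp
      then show "continuous_on UNIV (\<lambda>x. \<Prod>k<n. d ((F ^^ k) x))"
        by (intro continuous_on_prod)
      have "d x \<noteq> 0" for x
        using \<rho>(1) \<rho>(2)[of x] by auto
      then show "(\<Prod>k<n. d ((F ^^ k) x)) \<noteq> 0" for x
        by simp
      fix x y assume close: "\<bar>(F ^^ n) x - (F ^^ n) y\<bar> \<le> 1"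
      have "\<bar>\<Prod>k<n. d ((F ^^ k) x)\<bar>
          \<le> exp (M / (\<rho> - 1) * \<bar>(F ^^ n) x - (F ^^ n) y\<bar>) * \<bar>\<Prod>k<n. d ((F ^^ k) y)\<bar>"
        using expand \<rho>(1) M(1) step by (rule expanding_iterate_distortion)
      also have "\<dots> \<le> K * \<bar>\<Prod>k<n. d ((F ^^ k) y)\<bar>"
        using mult_left_mono[OF close, of "M / (\<rho> - 1)"] \<rho>(1) M(1)
        unfolding K_def by (intro mult_right_mono) auto
      finally show "\<bar>\<Prod>k<n. d ((F ^^ k) x)\<bar> \<le> K * \<bar>\<Prod>k<n. d ((F ^^ k) y)\<bar>" .
    qed
    moreover have "(F ^^ n) -` B = circle_proj -` ((T ^^ n) -` A)"
      by (auto simp: B_def F_iter)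
    ultimately show ?thesis
      using A TA by (simp add: emeasure_circle_measure B_def)
  qed
  show ?thesis
    by (rule that[OF bound])
qed

theorem proposition12:
  fixes T :: "circle \<Rightarrow> circle"
  assumes "expanding_map T"
  shows "\<exists>h :: circle \<Rightarrow> real.
    integrable circle_measure h \<and>
    (AE p in circle_measure. 0 \<le> h p) \<and>
    (LINT p|circle_measure. h p) = 1 \<and>
    (AE p in circle_measure. transfer_operator T h p = h p)"
proof -
  interpret finite_measure circle_measure
    by (rule finite_measure_circle_measure)
  obtain K :: real where K: "\<And>n A. A \<in> sets borel
      \<Longrightarrow> emeasure circle_measure ((T ^^ n) -` A) \<le> ennreal K * emeasure circle_measure A"
    using expanding_map_iterates_bounded[OF assms] by metis
  have "T \<in> borel_measurable borel"
    using assms by (auto simp: expanding_map_def intro: C2_circle_map_measurable)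
  then have T: "T \<in> measurable circle_measure circle_measure"
    by (simp add: measurable_def)
  have nonzero: "emeasure circle_measure (space circle_measure) \<noteq> 0"
    by (simp add: prob_space_circle_measure)
  have bound: "emeasure circle_measure ((T ^^ n) -` A \<inter> space circle_measure)
      \<le> ennreal K * emeasure circle_measure A" if "A \<in> sets circle_measure" for n A
    using K[of A n] that by simp
  have "\<exists>h :: circle \<Rightarrow> real. integrable circle_measure h \<and> (\<forall>p. 0 \<le> h p) \<and>
      (LINT p|circle_measure. h p) = 1 \<and> is_pushforward_density T h h"
    using invariant_density_if_bounded_iterates[OF T nonzero bound]
    by (auto simp: is_pushforward_density_def)
  then obtain h where h: "integrable circle_measure h" "\<And>p. 0 \<le> h p" "(LINT p|circle_measure. h p) = 1"
    and push: "is_pushforward_density T h h"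
    by blast
  have "AE p in circle_measure. transfer_operator T h p = h p"
    using is_pushforward_density_unique[OF
      is_pushforward_density_transfer_operator[OF assms h(1)] push] .
  then show ?thesis
    using h by auto
qed

end
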